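(* Let $(X,d)$ be a metric space and let $\phi:X\times X\to [0,\infty)$ be a mapping which is measurable in its first argument. Let $F:X\to [0,\infty]$ be measurable with $\mathrm{zer}F=\{z\}$, where the zero $z$ is strongly $\phi$-unique in expectation over a collection $D$ of $X$-valued random variables with a modulus $\tau:(0,\infty)\to (0,\infty)$, i.e. \[ \forall x\in D\ \forall \varepsilon>0\left( \mathbb{E}[F(x)]<\tau(\varepsilon)\to \mathbb{E}[\phi(x,z)]<\varepsilon\right). \] Let $(\mathcal{F}_n)$ be a filtration and let $(x_n)\subseteq D$ be a sequence of $X$-valued random variables, with $x_n$ being $\mathcal{F}_n$-measurable, such that $\phi(x_n,z)$ is integrable for all $n\in\mathbb{N}$. Suppose further that $(x_n)$ is stochastically $\phi$-quasi-Fejér monotone w.r.t. $\mathrm{zer}F$ and $(\mathcal{F}_n)$, i.e. \[ \mathbb{E}[\phi(x_{n+1},z)\mid\mathcal{F}_n]\leq (1+\zeta_n)\phi(x_n,z)+\xi_n\quad\text{a.s.} \] for all $n\in\mathbb{N}$, where $(\xi_n),(\zeta_n)$ are sequences of nonnegative, integrable real-valued random variables such that there exist $K>0$ and $\chi:(0,\infty)\to\mathbb{N}$ with $\prod_{n=0}^\infty (1+\zeta_n)<K$ a.s. and $\sum_{n=\chi(\varepsilon)}^\infty \mathbb{E}[\xi_n]<\varepsilon$ for all $\varepsilon>0$. Suppose furthermore that $(x_n)$ has the $\liminf$-property in expectation relative to $F$ with a bound $\varphi:(0,\infty)\times\mathbb{N}\to (0,\infty)$, i.e. \[ \forall \varepsilon>0\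 \forall N\in\mathbb{N}\ \exists n\in [N;\varphi(\varepsilon,N)]\left( \mathbb{E}[F(x_n)]<\varepsilon\right). \] Then $\mathbb{E}[\phi(x_n,z)]\to 0$ with rate \[ \rho(\varepsilon):=\varphi\left(\tau\left(\frac{\varepsilon}{2K}\right),\chi\left(\frac{\varepsilon}{2K}\right)\right) \] and $\phi(x_n,z)\to 0$ a.s. with rate $\rho'(\lambda,\varepsilon):=\rho(\lambda\varepsilon)$. If furthermore $\phi$ is uniformly consistent with modulus $\kappa:(0,\infty)\to (0,\infty)$, i.e. \[ \forall \varepsilon>0\ \forall x,y\in X\left(\phi(x,y)<\kappa(\varepsilon)\rightarrow d(x,y)<\varepsilon\right), \] then $d(x_n,z)\to 0$ a.s. with rate $\rho'(\lambda,\kappa(\varepsilon))$.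
   Context: All random variables live on a fixed probability space $(\Omega,\mathcal{F},\mathbb{P})$; $X$ carries its Borel $\sigma$-algebra. $\mathrm{zer}F:=\{x\in X: F(x)=0\}$. $[N;m]$ denotes the set of natural numbers $n$ with $N\le n\le m$. Rates: "$\mathbb{E}[Y_n]\to0$ with rate $\rho$" (for nonnegative $Y_n$) means $\forall\varepsilon>0\ \forall n\ge\rho(\varepsilon)\ (\mathbb{E}[Y_n]<\varepsilon)$. "$Y_n\to0$ a.s. with rate $\rho'(\lambda,\varepsilon)$" (for nonnegative $Y_n$) means $\forall\lambda,\varepsilon>0\ \left(\mathbb{P}(\exists n\ge\rho'(\lambda,\varepsilon)\ (Y_n\ge\varepsilon))<\lambda\right)$.
   Formalization: The formal theorem additionally assumes that each $\zeta_n$ is $\mathcal{F}_n$-measurable; without any adaptedness of $(\zeta_n)$ or $(\xi_n)$ the claimed rate for $\mathbb{E}[\phi(x_n,z)]$ can fail. *)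

theory Defs
  imports "HOL-Probability.Probability"
begin

definition zer :: "('a \<Rightarrow> ennreal) \<Rightarrow> 'a set" where
  "zer F = {x. F x = 0}"

(* Expectations of nonnegative random variables are nonnegative Lebesgue integrals, with values
   in [0, \<infinity>]. In particular a variable that is not integrable has infinite expectation. *)

definition strongly_unique_in_expectation ::
  "'w measure \<Rightarrow> ('w \<Rightarrow> 'a) set \<Rightarrow> ('a \<Rightarrow> 'a \<Rightarrow> real) \<Rightarrow> ('a \<Rightarrow> ennreal) \<Rightarrow> 'a \<Rightarrow> (real \<Rightarrow> real) \<Rightarrow> bool"
where
  "strongly_unique_in_expectation M D \<phi> F z \<tau> \<longleftrightarrow>
     (\<forall>\<epsilon>>0. \<tau> \<epsilon> > 0) \<and>
     (\<forall>x\<in>D. \<forall>\<epsilon>>0. (\<integral>\<^sup>+\<omega>. F (x \<omega>) \<partial>M) < ennreal (\<tau> \<epsilon>) \<longrightarrow>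
        (\<integral>\<^sup>+\<omega>. ennreal (\<phi> (x \<omega>) z) \<partial>M) < ennreal \<epsilon>)"

(* The inequality controls E[phi (x n) z] only if the factors \<zeta> n are Fil n-measurable, as in the
   Robbins-Siegmund setting. Without any adaptedness it allows E[phi (x n) z] to grow without bound,
   since \<zeta> n may then be large exactly where x (n + 1) is going to vanish. Adaptedness of \<zeta> is a
   separate hypothesis, and \<xi> need not be adapted. *)

definition stochastically_quasi_Fejer ::
  "'w measure \<Rightarrow> (nat \<Rightarrow> 'w measure) \<Rightarrow> ('a \<Rightarrow> 'a \<Rightarrow> real) \<Rightarrow> 'a set \<Rightarrow>
   (nat \<Rightarrow> 'w \<Rightarrow> real) \<Rightarrow> (nat \<Rightarrow> 'w \<Rightarrow> real) \<Rightarrow> (nat \<Rightarrow> 'w \<Rightarrow> 'a) \<Rightarrow> bool"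
where
  "stochastically_quasi_Fejer M Fil \<phi> S \<zeta> \<xi> x \<longleftrightarrow>
     (\<forall>z\<in>S. \<forall>n. AE \<omega> in M.
        real_cond_exp M (Fil n) (\<lambda>\<omega>. \<phi> (x (Suc n) \<omega>) z) \<omega>
          \<le> (1 + \<zeta> n \<omega>) * \<phi> (x n \<omega>) z + \<xi> n \<omega>)"

definition liminf_property_in_expectation ::
  "'w measure \<Rightarrow> ('a \<Rightarrow> ennreal) \<Rightarrow> (real \<Rightarrow> nat \<Rightarrow> real) \<Rightarrow> (nat \<Rightarrow> 'w \<Rightarrow> 'a) \<Rightarrow> bool"
where
  "liminf_property_in_expectation M F \<psi> x \<longleftrightarrow>
     (\<forall>\<epsilon>>0. \<forall>N. \<psi> \<epsilon> N > 0) \<and>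
     (\<forall>\<epsilon>>0. \<forall>N. \<exists>n. N \<le> n \<and> real n \<le> \<psi> \<epsilon> N \<and>
        (\<integral>\<^sup>+\<omega>. F (x n \<omega>) \<partial>M) < ennreal \<epsilon>)"

definition uniformly_consistent ::
  "('a::metric_space \<Rightarrow> 'a \<Rightarrow> real) \<Rightarrow> (real \<Rightarrow> real) \<Rightarrow> bool"
where
  "uniformly_consistent \<phi> \<kappa> \<longleftrightarrow>
     (\<forall>\<epsilon>>0. \<kappa> \<epsilon> > 0) \<and>
     (\<forall>\<epsilon>>0. \<forall>x y. \<phi> x y < \<kappa> \<epsilon> \<longrightarrow> dist x y < \<epsilon>)"

(* Both rate notions are meant for nonnegative random variables. *)

definition expectation_rate ::
  "'w measure \<Rightarrow> (nat \<Rightarrow> 'w \<Rightarrow> real) \<Rightarrow> (real \<Rightarrow> real) \<Rightarrow> bool"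
where
  "expectation_rate M Y \<rho> \<longleftrightarrow>
     (\<forall>\<epsilon>>0. \<forall>n. \<rho> \<epsilon> \<le> real n \<longrightarrow> (\<integral>\<^sup>+\<omega>. ennreal (Y n \<omega>) \<partial>M) < ennreal \<epsilon>)"

definition almost_sure_rate ::
  "'w measure \<Rightarrow> (nat \<Rightarrow> 'w \<Rightarrow> real) \<Rightarrow> (real \<Rightarrow> real \<Rightarrow> real) \<Rightarrow> bool"
where
  "almost_sure_rate M Y \<rho> \<longleftrightarrow>
     (\<forall>l>0. \<forall>\<epsilon>>0.
        measure M {\<omega> \<in> space M. \<exists>n. \<rho> l \<epsilon> \<le> real n \<and> \<epsilon> \<le> Y n \<omega>} < l)"

end

theory Submission
  imports Defs
begin

text \<open>
  Let $P_n = \prod_{i<n} (1 + \zeta_i)$, so that $1 \le P_n \le K$ almost surely. Dividing the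
  quasi-Fejer inequality by the $\mathcal{F}_n$-measurable factor $P_{n+1}$ shows that
  $U_n = \phi(x_n, z) / P_n$ is a nonnegative supermartingale up to the summable errors
  $\mathbb{E}[\xi_n]$. Its expectation after time $N$, and by a maximal inequality of Ville type also
  $a \cdot \mathbb{P}(\exists n \ge N.\, U_n \ge a)$, is therefore at most
  $\mathbb{E}[U_N] + \sum_{n \ge N} \mathbb{E}[\xi_n]$. The $\liminf$-property and the modulus of
  uniqueness provide an $N$ at which both summands are below $\varepsilon / 2K$, and returning from
  $U_n$ to $\phi(x_n, z)$ costs a factor $K$.
\<close>

section \<open>The one-step inequality for the normalized process\<close>

text \<open>An \<open>F\<close>-measurable weight can be pulled out of the conditional expectation,
  so \<open>w * Y\<close> and \<open>w * real_cond_exp M F Y\<close> have the same integral.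
  Integrability is asked of the weighted products because the bound
  \<open>(1 + \<zeta> n) * X n + \<xi>\<close> of the next lemma, where \<open>\<zeta>\<close> is
  not assumed bounded, may be integrable only after weighting.\<close>

lemma (in finite_measure_subalgebra) integral_mult_le_of_real_cond_exp_le:
  assumes le: "AE \<omega> in M. real_cond_exp M F Y \<omega> \<le> h \<omega>"
    and w: "w \<in> borel_measurable F" "\<And>\<omega>. \<omega> \<in> space M \<Longrightarrow> 0 \<le> w \<omega>"
    and Y: "Y \<in> borel_measurable M" "integrable M (\<lambda>\<omega>. w \<omega> * Y \<omega>)"
    and h: "integrable M (\<lambda>\<omega>. w \<omega> * h \<omega>)"
  shows "(\<integral>\<omega>. w \<omega> * Y \<omega> \<partial>M) \<le> (\<integral>\<omega>. w \<omega> * h \<omega> \<partial>M)"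
proof -
  have "(\<integral>\<omega>. w \<omega> * real_cond_exp M F Y \<omega> \<partial>M) \<le> (\<integral>\<omega>. w \<omega> * h \<omega> \<partial>M)"
  proof (rule integral_mono_AE)
    show "AE \<omega> in M. w \<omega> * real_cond_exp M F Y \<omega> \<le> w \<omega> * h \<omega>"
      using le AE_space by eventually_elim (simp add: mult_left_mono w(2))
  qed (use real_cond_exp_intg(1)[OF Y(2) w(1) Y(1)] h in auto)
  then show ?thesis
    using real_cond_exp_intg(2)[OF Y(2) w(1) Y(1)] by simp
qed

text \<open>The inequality is tested against the weight \<open>indicator A / P (Suc n)\<close>,
  which is \<open>Fil n\<close>-measurable because \<open>P (Suc n)\<close> involves only the
  factors up to \<open>\<zeta> n\<close>. The weight cancels \<open>1 + \<zeta> n\<close> and leaves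
  \<open>U n\<close>. Allowing any \<open>A\<close> in \<open>Fil n\<close> gives the
  supermartingale property in integrated form; the maximal inequality needs it on the events where a
  level has not yet been reached.\<close>

lemma normalized_quasi_supermartingale_step:
  fixes \<zeta> X :: "nat \<Rightarrow> 'w \<Rightarrow> real" and M :: "'w measure"
  assumes "finite_measure M" "filtration (space M) Fil" "subalgebra M (Fil n)"
    and X: "integrable M (X n)" "integrable M (X (Suc n))"
    and zeta: "\<And>n \<omega>. \<omega> \<in> space M \<Longrightarrow> 0 \<le> \<zeta> n \<omega>" "\<And>n. \<zeta> n \<in> borel_measurable (Fil n)"
    and xi: "integrable M \<xi>" "\<And>\<omega>. \<omega> \<in> space M \<Longrightarrow> 0 \<le> \<xi> \<omega>"
    and step: "AE \<omega> in M. real_cond_exp M (Fil n) (X (Suc n)) \<omega> \<le> (1 + \<zeta> n \<omega>) * X n \<omega> + \<xi> \<omega>"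
    and A: "A \<in> sets (Fil n)"
  defines "U \<equiv> \<lambda>n \<omega>. X n \<omega> / (\<Prod>i<n. 1 + \<zeta> i \<omega>)"
  shows "(\<integral>\<omega>. indicator A \<omega> * U (Suc n) \<omega> \<partial>M) \<le> (\<integral>\<omega>. indicator A \<omega> * U n \<omega> \<partial>M) + integral\<^sup>L M \<xi>"
proof -
  interpret filtration "space M" Fil by fact
  interpret finite_measure M by fact
  interpret finite_measure_subalgebra M "Fil n"
    by unfold_locales fact
  define P where "P = (\<lambda>n \<omega>. \<Prod>i<n. 1 + \<zeta> i \<omega>)"
  define w where "w = (\<lambda>\<omega>. indicator A \<omega> / P (Suc n) \<omega>)"
  have P_ge_1: "1 \<le> P k \<omega>" if "\<omega> \<in> space M" for k \<omega>
    unfolding P_def by (rule prod_ge_1) (simp add: zeta that)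
  \<comment> \<open>The product runs over \<open>i < k\<close>, so even for \<open>k = Suc n\<close>
    its last factor is \<open>1 + \<zeta> n\<close>, which is known at time
    \<open>n\<close>.\<close>
  have P_meas: "P k \<in> borel_measurable (Fil n)" if "k \<le> Suc n" for k
  proof -
    have "\<zeta> i \<in> borel_measurable (Fil n)" if "i < k" for i
      using measurable_from_subalg[of "Fil n" "Fil i", OF _ zeta(2)] sets_F_mono[of i n]
        that \<open>k \<le> Suc n\<close> by (simp add: subalgebra_def space_F)
    then show ?thesis unfolding P_def by (intro borel_measurable_prod) simp
  qed
  have w_meas [measurable]: "w \<in> borel_measurable (Fil n)"
    unfolding w_def using A P_meas[of "Suc n"] by measurable
  have w: "0 \<le> w \<omega>" "w \<omega> \<le> 1" if "\<omega> \<in> space M" for \<omega>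
    using P_ge_1[OF that, of "Suc n"] by (auto simp: w_def indicator_def)
  \<comment> \<open>Weights with values in [0, 1] preserve integrability. This serves both
    \<open>w\<close> and \<open>indicator A / P n\<close>.\<close>
  have bounded_int: "integrable M (\<lambda>\<omega>. v \<omega> * f \<omega>)"
    if "integrable M f" "v \<in> borel_measurable (Fil n)"
      "\<And>\<omega>. \<omega> \<in> space M \<Longrightarrow> 0 \<le> v \<omega> \<and> v \<omega> \<le> 1" for v f :: "'w \<Rightarrow> real"
  proof (rule Bochner_Integration.integrable_bound[OF that(1)])
    show "(\<lambda>\<omega>. v \<omega> * f \<omega>) \<in> borel_measurable M"
      using measurable_from_subalg[OF subalg that(2)] that(1) by measurable
    show "AE \<omega> in M. norm (v \<omega> * f \<omega>) \<le> norm (f \<omega>)"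
      using that(3) by (intro AE_I2) (auto simp: abs_mult intro!: mult_left_le_one_le)
  qed
  have U_int: "integrable M (\<lambda>\<omega>. indicator A \<omega> * U n \<omega>)"
  proof -
    have "integrable M (\<lambda>\<omega>. (indicator A \<omega> / P n \<omega>) * X n \<omega>)"
    proof (rule bounded_int[OF X(1)])
      show "(\<lambda>\<omega>. indicator A \<omega> / P n \<omega>) \<in> borel_measurable (Fil n)"
        using A P_meas[of n] by measurable
    qed (use P_ge_1[of _ n] in \<open>force simp: indicator_def\<close>)
    then show ?thesis by (simp add: U_def P_def)
  qed
  have w_xi_int: "integrable M (\<lambda>\<omega>. w \<omega> * \<xi> \<omega>)"
    using bounded_int[OF xi(1) w_meas] w by blast
  have w_rhs: "w \<omega> * ((1 + \<zeta> n \<omega>) * X n \<omega> + \<xi> \<omega>) = indicator A \<omega> * U n \<omega> + w \<omega> * \<xi> \<omega>"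
    if "\<omega> \<in> space M" for \<omega>
  proof -
    have "1 + \<zeta> n \<omega> \<noteq> 0" "P n \<omega> \<noteq> 0"
      using zeta(1)[OF that, of n] P_ge_1[OF that, of n] by auto
    moreover have "P (Suc n) \<omega> = P n \<omega> * (1 + \<zeta> n \<omega>)"
      by (simp add: P_def)
    ultimately have "w \<omega> * ((1 + \<zeta> n \<omega>) * X n \<omega>) = indicator A \<omega> * (X n \<omega> / P n \<omega>)"
      unfolding w_def by simp
    then show ?thesis
      by (simp add: U_def P_def distrib_left)
  qed
  have rhs_int: "integrable M (\<lambda>\<omega>. w \<omega> * ((1 + \<zeta> n \<omega>) * X n \<omega> + \<xi> \<omega>))"
    using Bochner_Integration.integrable_add[OF U_int w_xi_int]
    by (subst Bochner_Integration.integrable_cong[OF refl w_rhs]) auto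
  have "(\<integral>\<omega>. indicator A \<omega> * U (Suc n) \<omega> \<partial>M) = (\<integral>\<omega>. w \<omega> * X (Suc n) \<omega> \<partial>M)"
    by (simp add: U_def w_def P_def)
  also have "\<dots> \<le> (\<integral>\<omega>. w \<omega> * ((1 + \<zeta> n \<omega>) * X n \<omega> + \<xi> \<omega>) \<partial>M)"
    by (rule integral_mult_le_of_real_cond_exp_le[OF step w_meas w(1)])
      (use X bounded_int[OF X(2) w_meas] w rhs_int in auto)
  also have "\<dots> = (\<integral>\<omega>. indicator A \<omega> * U n \<omega> + w \<omega> * \<xi> \<omega> \<partial>M)"
    by (rule Bochner_Integration.integral_cong[OF refl w_rhs])
  also have "\<dots> = (\<integral>\<omega>. indicator A \<omega> * U n \<omega> \<partial>M) + (\<integral>\<omega>. w \<omega> * \<xi> \<omega> \<partial>M)"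
    by (rule Bochner_Integration.integral_add[OF U_int w_xi_int])
  \<comment> \<open>Normalization only shrinks the additive error, since \<open>w \<le> 1\<close>
    and \<open>\<xi>\<close> is nonnegative.\<close>
  also have "(\<integral>\<omega>. w \<omega> * \<xi> \<omega> \<partial>M) \<le> integral\<^sup>L M \<xi>"
    by (rule integral_mono[OF w_xi_int xi(1)]) (simp add: mult_left_le_one_le w xi(2))
  finally show ?thesis by simp
qed

section \<open>Bounds for supermartingales with summable errors\<close>

text \<open>Taking the whole space for \<open>A\<close> and telescoping from \<open>N\<close> to
  \<open>n\<close> accumulates finitely many errors, which are nonnegative and hence bounded by
  their series.\<close>

lemma quasi_supermartingale_expectation_le:
  fixes U :: "nat \<Rightarrow> 'w \<Rightarrow> real"
  assumes subalg: "\<And>n. subalgebra M (Fil n)"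
    and step: "\<And>n A. A \<in> sets (Fil n) \<Longrightarrow>
      (\<integral>\<omega>. indicator A \<omega> * U (Suc n) \<omega> \<partial>M) \<le> (\<integral>\<omega>. indicator A \<omega> * U n \<omega> \<partial>M) + c n"
    and c: "\<And>n. 0 \<le> c n" "summable (\<lambda>n. c (n + N))"
    and "N \<le> n"
  shows "integral\<^sup>L M (U n) \<le> integral\<^sup>L M (U N) + (\<Sum>n. c (n + N))"
proof -
  have step': "integral\<^sup>L M (U (Suc n)) \<le> integral\<^sup>L M (U n) + c n" for n
  proof -
    have "space M \<in> sets (Fil n)"
      using subalg[of n] by (metis sets.top subalgebra_def)
    from step[OF this] show ?thesis
      by (simp cong: Bochner_Integration.integral_cong)
  qed
  have "integral\<^sup>L M (U (k + N)) \<le> integral\<^sup>L M (U N) + (\<Sum>i<k. c (i + N))" for k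
  proof (induction k)
    case (Suc k)
    then show ?case using step'[of "k + N"] by simp
  qed simp
  from this[of "n - N"] show ?thesis
    using \<open>N \<le> n\<close> sum_le_suminf[OF c(2), of "{..<n - N}"] c(1) by simp
qed

text \<open>The process is frozen at the value \<open>a\<close> once it reaches the level
  \<open>a\<close>. Freezing never raises the expectation, and each time step raises it by at most
  \<open>c\<close>, so the mass \<open>a\<close> sitting on the event of having reached the level
  stays below the initial expectation plus the errors.\<close>

lemma quasi_supermartingale_maximal_inequality:
  fixes U :: "nat \<Rightarrow> 'w \<Rightarrow> real"
  assumes "finite_measure M" "filtration (space M) Fil" and subalg: "\<And>n. subalgebra M (Fil n)"
    and U: "\<And>n. U n \<in> borel_measurable (Fil n)" "\<And>n. integrable M (U n)"
      "\<And>n \<omega>. \<omega> \<in> space M \<Longrightarrow> 0 \<le> U n \<omega>"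
    and step: "\<And>n A. A \<in> sets (Fil n) \<Longrightarrow>
      (\<integral>\<omega>. indicator A \<omega> * U (Suc n) \<omega> \<partial>M) \<le> (\<integral>\<omega>. indicator A \<omega> * U n \<omega> \<partial>M) + c n"
    and c: "\<And>n. 0 \<le> c n" "summable (\<lambda>n. c (n + N))"
    and a: "0 < a"
  shows "a * measure M {\<omega> \<in> space M. \<exists>n\<ge>N. a \<le> U n \<omega>} \<le> integral\<^sup>L M (U N) + (\<Sum>n. c (n + N))"
proof -
  interpret filtration "space M" Fil by fact
  interpret finite_measure M by fact
  have U_meas [measurable]: "U n \<in> borel_measurable M" for n
    using measurable_from_subalg[OF subalg U(1)] .
  \<comment> \<open>\<open>H k\<close> looks at the times from \<open>N\<close> to
    \<open>N + k - 1\<close> only. Thus \<open>H 0\<close> is empty, and \<open>H (Suc k)\<close> is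
    decided at time \<open>k + N\<close>, just in time for the step from \<open>k + N\<close> to the
    next index.\<close>
  define H where "H = (\<lambda>k. {\<omega> \<in> space M. \<exists>i<k. a \<le> U (i + N) \<omega>})"
  have H_sets [measurable]: "H k \<in> sets M" for k
    unfolding H_def by measurable
  have compl_H_Fil: "space M - H (Suc k) \<in> sets (Fil (k + N))" for k
  proof -
    have "{\<omega> \<in> space (Fil (k + N)). \<forall>i\<in>{..<Suc k}. \<not> a \<le> U (i + N) \<omega>} \<in> sets (Fil (k + N))"
    proof (rule sets.sets_Collect_finite_All)
      fix i assume "i \<in> {..<Suc k}"
      then have "subalgebra (Fil (k + N)) (Fil (i + N))"
        using sets_F_mono[of "i + N" "k + N"] by (simp add: subalgebra_def space_F)
      from measurable_from_subalg[OF this U(1)]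
      show "{\<omega> \<in> space (Fil (k + N)). \<not> a \<le> U (i + N) \<omega>} \<in> sets (Fil (k + N))"
        by measurable
    qed simp
    also have "{\<omega> \<in> space (Fil (k + N)). \<forall>i\<in>{..<Suc k}. \<not> a \<le> U (i + N) \<omega>} = space M - H (Suc k)"
      by (auto simp: H_def space_F)
    finally show ?thesis .
  qed
  have ind_int: "integrable M (\<lambda>\<omega>. indicator B \<omega> * U n \<omega>)" if "B \<in> sets M" for B n
    using integrable_mult_indicator[OF that U(2)[of n]] by simp
  \<comment> \<open>On the set where the level is reached for the first time at index \<open>k + N\<close>, the variable
    \<open>U (k + N)\<close> is at least \<open>a\<close>.\<close>
  have first_hit: "a * measure M (H (Suc k)) + (\<integral>\<omega>. indicator (space M - H (Suc k)) \<omega> * U (k + N) \<omega> \<partial>M)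
      \<le> a * measure M (H k) + (\<integral>\<omega>. indicator (space M - H k) \<omega> * U (k + N) \<omega> \<partial>M)" for k
  proof -
    have "(\<integral>\<omega>. a * indicator (H (Suc k)) \<omega> + indicator (space M - H (Suc k)) \<omega> * U (k + N) \<omega> \<partial>M)
      \<le> (\<integral>\<omega>. a * indicator (H k) \<omega> + indicator (space M - H k) \<omega> * U (k + N) \<omega> \<partial>M)"
    proof (rule integral_mono)
      fix \<omega> assume "\<omega> \<in> space M"
      then show "a * indicator (H (Suc k)) \<omega> + indicator (space M - H (Suc k)) \<omega> * U (k + N) \<omega>
        \<le> a * indicator (H k) \<omega> + indicator (space M - H k) \<omega> * U (k + N) \<omega>"
        by (auto simp: H_def indicator_def less_Suc_eq)
    qed (auto intro!: Bochner_Integration.integrable_add ind_int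
          simp: emeasure_eq_measure less_top[symmetric])
    then show ?thesis
      by (simp add: Bochner_Integration.integral_add ind_int emeasure_eq_measure less_top[symmetric]
          Int_absorb2 sets.sets_into_space)
  qed
  have bound: "a * measure M (H k) + (\<integral>\<omega>. indicator (space M - H k) \<omega> * U (k + N) \<omega> \<partial>M)
      \<le> integral\<^sup>L M (U N) + (\<Sum>i<k. c (i + N))" for k
  proof (induction k)
    case 0
    have "H 0 = {}" by (simp add: H_def)
    then show ?case by (simp cong: Bochner_Integration.integral_cong)
  next
    case (Suc k)
    then show ?case
      using first_hit[of k] step[OF compl_H_Fil[of k]] by simp
  qed
  have "a * measure M (H k) \<le> integral\<^sup>L M (U N) + (\<Sum>n. c (n + N))" for k
  proof -
    have "0 \<le> (\<integral>\<omega>. indicator (space M - H k) \<omega> * U (k + N) \<omega> \<partial>M)"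
      by (rule integral_nonneg_AE) (simp add: U(3))
    moreover have "(\<Sum>i<k. c (i + N)) \<le> (\<Sum>n. c (n + N))"
      by (rule sum_le_suminf[OF c(2)]) (simp_all add: c(1))
    ultimately show ?thesis using bound[of k] by linarith
  qed
  \<comment> \<open>The bound is uniform in \<open>k\<close>, so continuity of the measure along the
    increasing events \<open>H k\<close> carries it over to the infinite horizon.\<close>
  moreover have "(\<lambda>k. a * measure M (H k)) \<longlonglongrightarrow> a * measure M (\<Union>k. H k)"
    by (intro tendsto_mult_left finite_Lim_measure_incseq)
      (auto simp: incseq_def H_def intro: less_le_trans)
  moreover have "(\<Union>k. H k) = {\<omega> \<in> space M. \<exists>n\<ge>N. a \<le> U n \<omega>}"
  proof (intro set_eqI iffI)
    fix \<omega> assume "\<omega> \<in> {\<omega> \<in> space M. \<exists>n\<ge>N. a \<le> U n \<omega>}"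
    then obtain n where "\<omega> \<in> space M" "N \<le> n" "a \<le> U n \<omega>" by blast
    then have "\<omega> \<in> H (Suc (n - N))"
      unfolding H_def by (auto intro!: exI[of _ "n - N"])
    then show "\<omega> \<in> (\<Union>k. H k)" by blast
  qed (auto simp: H_def intro: le_add2)
  ultimately show ?thesis
    by (metis (no_types, lifting) LIMSEQ_le_const2)
qed

section \<open>Rates in expectation and almost surely\<close>

theorem theorem5p5:
  fixes M :: "'w measure"
    and \<phi> :: "'a::metric_space \<Rightarrow> 'a \<Rightarrow> real"
    and F :: "'a \<Rightarrow> ennreal"
    and z :: 'a
    and D :: "('w \<Rightarrow> 'a) set"
    and \<tau> :: "real \<Rightarrow> real"
    and Fil :: "nat \<Rightarrow> 'w measure"
    and x :: "nat \<Rightarrow> 'w \<Rightarrow> 'a"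
    and \<zeta> \<xi> :: "nat \<Rightarrow> 'w \<Rightarrow> real"
    and K :: real
    and r :: "real \<Rightarrow> nat"
    and \<psi> :: "real \<Rightarrow> nat \<Rightarrow> real"
  assumes prob: "prob_space M"
    and phi_nonneg: "\<And>u v. 0 \<le> \<phi> u v"
    and phi_meas: "\<And>v. (\<lambda>u. \<phi> u v) \<in> borel_measurable borel"
    and F_meas: "F \<in> borel_measurable borel"
    and zer_F: "zer F = {z}"
    and D_rv: "D \<subseteq> borel_measurable M"
    and unique: "strongly_unique_in_expectation M D \<phi> F z \<tau>"
    and filtr: "filtration (space M) Fil"
    and subalg: "\<And>n. subalgebra M (Fil n)"
    and x_D: "\<And>n. x n \<in> D"
    and x_adapted: "\<And>n. x n \<in> borel_measurable (Fil n)"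
    and phi_x_int: "\<And>n. integrable M (\<lambda>\<omega>. \<phi> (x n \<omega>) z)"
    and zeta_nonneg: "\<And>n \<omega>. \<omega> \<in> space M \<Longrightarrow> 0 \<le> \<zeta> n \<omega>"
    and zeta_int: "\<And>n. integrable M (\<zeta> n)"
    and zeta_adapted: "\<And>n. \<zeta> n \<in> borel_measurable (Fil n)"
    and xi_nonneg: "\<And>n \<omega>. \<omega> \<in> space M \<Longrightarrow> 0 \<le> \<xi> n \<omega>"
    and xi_int: "\<And>n. integrable M (\<xi> n)"
    and fejer: "stochastically_quasi_Fejer M Fil \<phi> (zer F) \<zeta> \<xi> x"
    and K_pos: "0 < K"
    and K_bound: "AE \<omega> in M. convergent_prod (\<lambda>n. 1 + \<zeta> n \<omega>) \<and> prodinf (\<lambda>n. 1 + \<zeta> n \<omega>) < K"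
    and r_tail: "\<And>\<epsilon>. 0 < \<epsilon> \<Longrightarrow> summable (\<lambda>n. integral\<^sup>L M (\<xi> (n + r \<epsilon>))) \<and>
                (\<Sum>n. integral\<^sup>L M (\<xi> (n + r \<epsilon>))) < \<epsilon>"
    and liminf: "liminf_property_in_expectation M F \<psi> x"
  shows "let \<rho> = (\<lambda>\<epsilon>. \<psi> (\<tau> (\<epsilon> / (2 * K))) (r (\<epsilon> / (2 * K))));
             \<rho>' = (\<lambda>l \<epsilon>. \<rho> (l * \<epsilon>))
         in expectation_rate M (\<lambda>n \<omega>. \<phi> (x n \<omega>) z) \<rho>
          \<and> almost_sure_rate M (\<lambda>n \<omega>. \<phi> (x n \<omega>) z) \<rho>'
          \<and> (\<forall>\<kappa>. uniformly_consistent \<phi> \<kappa> \<longrightarrow>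
                almost_sure_rate M (\<lambda>n \<omega>. dist (x n \<omega>) z) (\<lambda>l \<epsilon>. \<rho>' l (\<kappa> \<epsilon>)))"
proof -
  interpret prob_space M by fact
  define X where "X = (\<lambda>n \<omega>. \<phi> (x n \<omega>) z)"
  define P where "P = (\<lambda>n \<omega>. \<Prod>i<n. 1 + \<zeta> i \<omega>)"
  define U where "U = (\<lambda>n \<omega>. X n \<omega> / P n \<omega>)"
  define c where "c = (\<lambda>n. integral\<^sup>L M (\<xi> n))"
  define \<rho> where "\<rho> = (\<lambda>\<epsilon>. \<psi> (\<tau> (\<epsilon> / (2 * K))) (r (\<epsilon> / (2 * K))))"
  have X_nonneg: "0 \<le> X n \<omega>" for n \<omega>
    by (simp add: X_def phi_nonneg)
  have X_int: "integrable M (X n)" for n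
    using phi_x_int by (simp add: X_def)
  have P_ge_1: "1 \<le> P k \<omega>" if "\<omega> \<in> space M" for k \<omega>
    unfolding P_def by (rule prod_ge_1) (simp add: zeta_nonneg that)
  have U_nonneg: "0 \<le> U n \<omega>" and U_le_X: "U n \<omega> \<le> X n \<omega>" if "\<omega> \<in> space M" for n \<omega>
    using P_ge_1[OF that, of n] X_nonneg[of n \<omega>]
    by (auto simp: U_def divide_le_eq mult_le_cancel_left1)
  have U_meas: "U n \<in> borel_measurable (Fil n)" for n
  proof -
    have "\<zeta> i \<in> borel_measurable (Fil n)" if "i < n" for i
      using measurable_from_subalg[of "Fil n" "Fil i", OF _ zeta_adapted]
        filtration.sets_F_mono[OF filtr, of i n] filtration.space_F[OF filtr] that
      by (simp add: subalgebra_def)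
    then have "P n \<in> borel_measurable (Fil n)"
      unfolding P_def by (intro borel_measurable_prod) simp
    moreover have "X n \<in> borel_measurable (Fil n)"
      unfolding X_def by (rule measurable_compose[OF x_adapted phi_meas])
    ultimately show ?thesis unfolding U_def by measurable
  qed
  have U_int: "integrable M (U n)" for n
  proof (rule Bochner_Integration.integrable_bound[OF X_int])
    show "U n \<in> borel_measurable M"
      using measurable_from_subalg[OF subalg U_meas] .
    show "AE \<omega> in M. norm (U n \<omega>) \<le> norm (X n \<omega>)"
      by (intro AE_I2) (simp add: U_nonneg U_le_X X_nonneg)
  qed
  \<comment> \<open>All factors are at least 1, so every partial product is bounded by the infinite
    product and hence by \<open>K\<close>. The quantifier over \<open>n\<close> stands inside the
    almost-everywhere statement: one null set must serve all indices in the event of the almost sure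
    rate.\<close>
  have X_le_KU: "AE \<omega> in M. \<forall>n. X n \<omega> \<le> K * U n \<omega>"
    using K_bound AE_space
  proof eventually_elim
    case (elim \<omega>)
    have "P n \<omega> \<le> K" for n
    proof -
      have "P n \<omega> \<le> prodinf (\<lambda>n. 1 + \<zeta> n \<omega>)"
        unfolding P_def using elim zeta_nonneg[of \<omega>]
        by (intro prod_le_prodinf) (auto simp: convergent_prod_has_prod_iff)
      then show ?thesis using elim by simp
    qed
    then have "P n \<omega> * U n \<omega> \<le> K * U n \<omega>" for n
      using elim by (intro mult_right_mono U_nonneg) auto
    moreover have "P n \<omega> * U n \<omega> = X n \<omega>" for n
      using P_ge_1[of \<omega> n] elim by (auto simp: U_def)
    ultimately show ?case by simp
  qed
  have step: "(\<integral>\<omega>. indicator A \<omega> * U (Suc n) \<omega> \<partial>M) \<le> (\<integral>\<omega>. indicator A \<omega> * U n \<omega> \<partial>M) + c n"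
    if "A \<in> sets (Fil n)" for n A
    unfolding U_def P_def c_def
  proof (rule normalized_quasi_supermartingale_step[OF finite_measure_axioms filtr subalg X_int X_int])
    show "AE \<omega> in M. real_cond_exp M (Fil n) (X (Suc n)) \<omega> \<le> (1 + \<zeta> n \<omega>) * X n \<omega> + \<xi> n \<omega>"
      using fejer zer_F by (simp add: stochastically_quasi_Fejer_def X_def)
  qed (fact zeta_nonneg zeta_adapted xi_int xi_nonneg that | simp add: zeta_nonneg xi_nonneg)+
  have c_nonneg: "0 \<le> c n" for n
    unfolding c_def by (rule integral_nonneg_AE) (simp add: xi_nonneg)
  \<comment> \<open>Both rates start from such an \<open>N\<close>: every index \<open>n\<close>
    beyond \<open>\<rho> \<epsilon>\<close> satisfies \<open>N \<le> n\<close>, and the target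
    \<open>\<epsilon> / K\<close> anticipates the factor \<open>K\<close> lost in returning from
    \<open>U\<close> to \<open>X\<close>.\<close>
  have start: "\<exists>N. real N \<le> \<rho> \<epsilon> \<and> summable (\<lambda>n. c (n + N)) \<and>
      integral\<^sup>L M (U N) + (\<Sum>n. c (n + N)) < \<epsilon> / K" if "0 < \<epsilon>" for \<epsilon>
  proof -
    \<comment> \<open>Half of the target \<open>\<epsilon> / K\<close> is reserved for the
      expectation of \<open>U N\<close>, the other half for the tail of the errors.\<close>
    define \<delta> where "\<delta> = \<epsilon> / (2 * K)"
    have "0 < \<delta>" using that K_pos by (simp add: \<delta>_def)
    then have "0 < \<tau> \<delta>" using unique by (simp add: strongly_unique_in_expectation_def)
    then obtain N where N: "r \<delta> \<le> N" "real N \<le> \<psi> (\<tau> \<delta>) (r \<delta>)"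
      and F: "(\<integral>\<^sup>+\<omega>. F (x N \<omega>) \<partial>M) < ennreal (\<tau> \<delta>)"
      using liminf unfolding liminf_property_in_expectation_def by blast
    have "(\<integral>\<^sup>+\<omega>. ennreal (X N \<omega>) \<partial>M) < ennreal \<delta>"
      using unique F x_D \<open>0 < \<delta>\<close> unfolding strongly_unique_in_expectation_def X_def by blast
    then have "integral\<^sup>L M (X N) < \<delta>"
      using \<open>0 < \<delta>\<close> by (simp add: nn_integral_eq_integral X_int X_nonneg ennreal_less_iff)
    moreover have "integral\<^sup>L M (U N) \<le> integral\<^sup>L M (X N)"
      by (rule integral_mono[OF U_int X_int U_le_X])
    moreover have "summable (\<lambda>n. c (n + N)) \<and> (\<Sum>n. c (n + N)) < \<delta>"
    proof -
      \<comment> \<open>The modulus \<open>r\<close> controls the tail from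
        \<open>r \<delta>\<close> on; starting at the later index \<open>N\<close> only discards
        nonnegative terms.\<close>
      obtain k where k: "N = k + r \<delta>" using N(1) by (metis le_add_diff_inverse2)
      have tail: "summable (\<lambda>n. c (n + r \<delta>))" "(\<Sum>n. c (n + r \<delta>)) < \<delta>"
        using r_tail[OF \<open>0 < \<delta>\<close>] by (auto simp: c_def)
      have "summable (\<lambda>n. c (n + k + r \<delta>))"
        using tail(1) summable_iff_shift[of "\<lambda>n. c (n + r \<delta>)" k] by simp
      moreover have "(\<Sum>n. c (n + k + r \<delta>)) \<le> (\<Sum>n. c (n + r \<delta>))"
        using suminf_split_initial_segment[OF tail(1), of k] c_nonneg by (simp add: sum_nonneg)
      ultimately show ?thesis using tail(2) by (simp add: k add.assoc)
    qed
    moreover have "\<delta> + \<delta> = \<epsilon> / K" by (simp add: \<delta>_def)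
    ultimately show ?thesis using N(2) unfolding \<rho>_def \<delta>_def[symmetric] by (intro exI[of _ N]) auto
  qed
  have exp_rate: "expectation_rate M X \<rho>"
    unfolding expectation_rate_def
  proof (intro allI impI)
    fix \<epsilon> :: real and n assume "0 < \<epsilon>" and n: "\<rho> \<epsilon> \<le> real n"
    then obtain N where N: "real N \<le> \<rho> \<epsilon>" "summable (\<lambda>n. c (n + N))"
      "integral\<^sup>L M (U N) + (\<Sum>n. c (n + N)) < \<epsilon> / K"
      using start by blast
    have "integral\<^sup>L M (X n) \<le> (\<integral>\<omega>. K * U n \<omega> \<partial>M)"
      using X_le_KU by (intro integral_mono_AE X_int integrable_mult_right U_int) auto
    also have "\<dots> = K * integral\<^sup>L M (U n)" by simp
    also have "\<dots> \<le> K * (integral\<^sup>L M (U N) + (\<Sum>n. c (n + N)))"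
      using N n K_pos quasi_supermartingale_expectation_le[OF subalg step c_nonneg N(2), where n = n]
      by (intro mult_left_mono) auto
    also have "\<dots> < \<epsilon>"
      using N(3) K_pos by (simp add: pos_less_divide_eq mult.commute)
    finally show "(\<integral>\<^sup>+\<omega>. ennreal (X n \<omega>) \<partial>M) < ennreal \<epsilon>"
      using \<open>0 < \<epsilon>\<close> by (simp add: nn_integral_eq_integral X_int X_nonneg ennreal_less_iff)
  qed
  have X_meas [measurable]: "X n \<in> borel_measurable M" for n
    using X_int by blast
  have as_rate: "almost_sure_rate M X (\<lambda>l \<epsilon>. \<rho> (l * \<epsilon>))"
    unfolding almost_sure_rate_def
  proof (intro allI impI)
    fix l \<epsilon> :: real assume "0 < l" "0 < \<epsilon>"
    \<comment> \<open>The argument \<open>l * \<epsilon>\<close> is chosen because the maximal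
      inequality at level \<open>\<epsilon> / K\<close> bounds the probability only after
      multiplication by \<open>\<epsilon> / K\<close>; dividing this factor out of
      \<open>l * \<epsilon> / K\<close> leaves exactly \<open>l\<close>.\<close>
    then obtain N where N: "real N \<le> \<rho> (l * \<epsilon>)" "summable (\<lambda>n. c (n + N))"
      "integral\<^sup>L M (U N) + (\<Sum>n. c (n + N)) < l * \<epsilon> / K"
      using start[of "l * \<epsilon>"] by auto
    have [measurable]: "U n \<in> borel_measurable M" for n
      using U_int by blast
    \<comment> \<open>Outside the null set of \<open>X_le_KU\<close>,
      \<open>\<epsilon> \<le> X n\<close> forces \<open>\<epsilon> / K \<le> U n\<close>, so the
      event moves to the process for which the maximal inequality is available.\<close>
    have "measure M {\<omega> \<in> space M. \<exists>n. \<rho> (l * \<epsilon>) \<le> real n \<and> \<epsilon> \<le> X n \<omega>}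
      \<le> measure M {\<omega> \<in> space M. \<exists>n\<ge>N. \<epsilon> / K \<le> U n \<omega>}"
    proof (rule finite_measure_mono_AE)
      show "AE \<omega> in M. \<omega> \<in> {\<omega> \<in> space M. \<exists>n. \<rho> (l * \<epsilon>) \<le> real n \<and> \<epsilon> \<le> X n \<omega>} \<longrightarrow>
        \<omega> \<in> {\<omega> \<in> space M. \<exists>n\<ge>N. \<epsilon> / K \<le> U n \<omega>}"
        using X_le_KU
      proof eventually_elim
        case (elim \<omega>)
        have "N \<le> n \<and> \<epsilon> / K \<le> U n \<omega>" if "\<rho> (l * \<epsilon>) \<le> real n" "\<epsilon> \<le> X n \<omega>" for n
          using that elim[rule_format, of n] N(1) K_pos by (simp add: pos_divide_le_eq mult.commute)
        then show ?case by blast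
      qed
    qed measurable
    moreover have "\<epsilon> / K * measure M {\<omega> \<in> space M. \<exists>n\<ge>N. \<epsilon> / K \<le> U n \<omega>} < \<epsilon> / K * l"
      using quasi_supermartingale_maximal_inequality[OF finite_measure_axioms filtr subalg U_meas U_int
          U_nonneg step c_nonneg N(2), of "\<epsilon> / K"] N(3) \<open>0 < \<epsilon>\<close> K_pos
      by (simp add: mult.commute)
    ultimately show "measure M {\<omega> \<in> space M. \<exists>n. \<rho> (l * \<epsilon>) \<le> real n \<and> \<epsilon> \<le> X n \<omega>} < l"
      using \<open>0 < \<epsilon>\<close> K_pos by (meson divide_pos_pos mult_less_cancel_left_pos order_le_less_trans)
  qed
  have dist_rate: "almost_sure_rate M (\<lambda>n \<omega>. dist (x n \<omega>) z) (\<lambda>l \<epsilon>. \<rho> (l * \<kappa> \<epsilon>))"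
    if "uniformly_consistent \<phi> \<kappa>" for \<kappa>
    unfolding almost_sure_rate_def
  proof (intro allI impI)
    fix l \<epsilon> :: real assume "0 < l" "0 < \<epsilon>"
    \<comment> \<open>Uniform consistency in contrapositive form: it embeds the event for the
      distance into the event for \<open>X\<close> at level \<open>\<kappa> \<epsilon>\<close>, to
      which \<open>as_rate\<close> applies.\<close>
    have \<kappa>_le: "\<kappa> \<epsilon> \<le> X n \<omega>" if "\<epsilon> \<le> dist (x n \<omega>) z" for n \<omega>
    proof (rule ccontr)
      assume "\<not> \<kappa> \<epsilon> \<le> X n \<omega>"
      then have "dist (x n \<omega>) z < \<epsilon>"
        using \<open>uniformly_consistent \<phi> \<kappa>\<close> \<open>0 < \<epsilon>\<close> by (simp add: uniformly_consistent_def X_def)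
      with that show False by simp
    qed
    have "measure M {\<omega> \<in> space M. \<exists>n. \<rho> (l * \<kappa> \<epsilon>) \<le> real n \<and> \<epsilon> \<le> dist (x n \<omega>) z}
      \<le> measure M {\<omega> \<in> space M. \<exists>n. \<rho> (l * \<kappa> \<epsilon>) \<le> real n \<and> \<kappa> \<epsilon> \<le> X n \<omega>}"
    proof (rule finite_measure_mono)
      show "{\<omega> \<in> space M. \<exists>n. \<rho> (l * \<kappa> \<epsilon>) \<le> real n \<and> \<epsilon> \<le> dist (x n \<omega>) z}
        \<subseteq> {\<omega> \<in> space M. \<exists>n. \<rho> (l * \<kappa> \<epsilon>) \<le> real n \<and> \<kappa> \<epsilon> \<le> X n \<omega>}"
        using \<kappa>_le by blast
    qed measurable
    also have "\<dots> < l"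
      using as_rate \<open>0 < l\<close> \<open>0 < \<epsilon>\<close> \<open>uniformly_consistent \<phi> \<kappa>\<close>
      by (simp add: almost_sure_rate_def uniformly_consistent_def)
    finally show "measure M {\<omega> \<in> space M. \<exists>n. \<rho> (l * \<kappa> \<epsilon>) \<le> real n \<and> \<epsilon> \<le> dist (x n \<omega>) z} < l" .
  qed
  show ?thesis
    unfolding Let_def using exp_rate as_rate dist_rate unfolding \<rho>_def X_def by blast
qed

end
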